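(* For every $n\geq 2$ there exist an integer $k\geq 1$ and a collection of graphs $G_1,\dots,G_k$, each with exactly $n$ edges, which is not reconstructable up to isomorphism from the multiset union $\coprod_{i=1}^k\mathrm{ED}(G_i)$; that is, there is another collection $G_1',\dots,G_k'$ of graphs with exactly $n$ edges such that $\coprod_{i=1}^k\mathrm{ED}(G_i)=\coprod_{i=1}^k\mathrm{ED}(G_i')$ as multisets of isomorphism classes of graphs, but the multisets of isomorphism classes $\{G_1,\dots,G_k\}$ and $\{G_1',\dots,G_k'\}$ are different.
   Context: A graph is a finite simple undirected graph without loops (isolated vertices are allowed). For an edge $e$ of a graph $G$, $G-e$ denotes the graph with the same vertex set as $G$ and with the edge $e$ removed. The edge deck $\mathrm{ED}(G)$ is the multiset of isomorphism classes of the graphs $G-e$, where $e$ ranges over all edges of $G$. The symbol $\coprod$ denotes disjoint union (sum) of multisets. *)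

theory Defs
  imports Main "HOL-Library.Multiset"
begin

record 'a ugraph =
  verts :: "'a set"
  edges :: "'a set set"

definition simple_graph :: "'a ugraph \<Rightarrow> bool" where
  "simple_graph G \<longleftrightarrow> finite (verts G) \<and> (\<forall>e \<in> edges G. e \<subseteq> verts G \<and> card e = 2)"

definition del_edge :: "'a ugraph \<Rightarrow> 'a set \<Rightarrow> 'a ugraph" where
  "del_edge G e = \<lparr>verts = verts G, edges = edges G - {e}\<rparr>"

definition graph_iso :: "'a ugraph \<Rightarrow> 'b ugraph \<Rightarrow> bool" where
  "graph_iso G H \<longleftrightarrow>
    (\<exists>f. bij_betw f (verts G) (verts H) \<and>
         (\<forall>u \<in> verts G. \<forall>v \<in> verts G. {u, v} \<in> edges G \<longleftrightarrow> {f u, f v} \<in> edges H))"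

text \<open>Vertices are natural numbers, so that all isomorphism classes of finite graphs live in one type.
  Nothing is lost, by \<open>ex_nat_graph_iso\<close> below.\<close>

definition iso_class :: "nat ugraph \<Rightarrow> nat ugraph set" where
  "iso_class G = {H. simple_graph H \<and> graph_iso G H}"

definition edge_deck :: "nat ugraph \<Rightarrow> nat ugraph set multiset" where
  "edge_deck G = image_mset (\<lambda>e. iso_class (del_edge G e)) (mset_set (edges G))"

lemma simple_graph_finite_edges:
  assumes "simple_graph G"
  shows "finite (edges G)"
proof (rule finite_subset)
  show "edges G \<subseteq> Pow (verts G)" using assms by (auto simp: simple_graph_def)
  show "finite (Pow (verts G))" using assms by (simp add: simple_graph_def)
qed

lemma simple_graph_del_edge: "simple_graph G \<Longrightarrow> simple_graph (del_edge G e)"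
  by (auto simp: simple_graph_def del_edge_def)

lemma graph_iso_refl: "graph_iso G G"
  unfolding graph_iso_def by (rule exI[of _ id]) auto

lemma graph_iso_sym:
  assumes "graph_iso G H"
  shows "graph_iso H G"
proof -
  obtain f where f: "bij_betw f (verts G) (verts H)"
    and e: "\<And>u v. u \<in> verts G \<Longrightarrow> v \<in> verts G \<Longrightarrow> {u, v} \<in> edges G \<longleftrightarrow> {f u, f v} \<in> edges H"
    using assms unfolding graph_iso_def by blast
  let ?g = "inv_into (verts G) f"
  have g: "bij_betw ?g (verts H) (verts G)" using f by (rule bij_betw_inv_into)
  have "{u, v} \<in> edges H \<longleftrightarrow> {?g u, ?g v} \<in> edges G" if "u \<in> verts H" "v \<in> verts H" for u v
    using e[of "?g u" "?g v"] that bij_betw_inv_into_right[OF f] bij_betwE[OF g] by auto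
  with g show ?thesis unfolding graph_iso_def by blast
qed

lemma graph_iso_trans:
  assumes "graph_iso G H" and "graph_iso H K"
  shows "graph_iso G K"
proof -
  obtain f where f: "bij_betw f (verts G) (verts H)"
    and fe: "\<forall>u \<in> verts G. \<forall>v \<in> verts G. {u, v} \<in> edges G \<longleftrightarrow> {f u, f v} \<in> edges H"
    using assms(1) unfolding graph_iso_def by blast
  obtain g where g: "bij_betw g (verts H) (verts K)"
    and ge: "\<forall>u \<in> verts H. \<forall>v \<in> verts H. {u, v} \<in> edges H \<longleftrightarrow> {g u, g v} \<in> edges K"
    using assms(2) unfolding graph_iso_def by blast
  show ?thesis unfolding graph_iso_def
  proof (intro exI conjI)
    show "bij_betw (g \<circ> f) (verts G) (verts K)" using f g by (rule bij_betw_trans)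
    show "\<forall>u \<in> verts G. \<forall>v \<in> verts G. {u, v} \<in> edges G \<longleftrightarrow> {(g \<circ> f) u, (g \<circ> f) v} \<in> edges K"
      using fe ge bij_betwE[OF f] by simp
  qed
qed

lemma iso_class_eq_iff:
  assumes "simple_graph G" and "simple_graph H"
  shows "iso_class G = iso_class H \<longleftrightarrow> graph_iso G H"
  using assms unfolding iso_class_def
  by (auto intro: graph_iso_refl graph_iso_trans graph_iso_sym)

lemma ex_nat_graph_iso:
  fixes G :: "'a ugraph"
  assumes "simple_graph G"
  shows "\<exists>H :: nat ugraph. simple_graph H \<and> graph_iso G H"
proof -
  have fin: "finite (verts G)" and edg: "\<And>e. e \<in> edges G \<Longrightarrow> e \<subseteq> verts G \<and> card e = 2"
    using assms by (auto simp: simple_graph_def)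
  obtain f :: "'a \<Rightarrow> nat" where f: "inj_on f (verts G)"
    using finite_imp_inj_to_nat_seg[OF fin] by blast
  let ?H = "\<lparr>verts = f ` verts G, edges = (\<lambda>e. f ` e) ` edges G\<rparr>"
  have "card (f ` e) = 2" if "e \<in> edges G" for e
    using edg[OF that] card_image[OF inj_on_subset[OF f]] by auto
  then have "simple_graph ?H"
    using fin edg by (fastforce simp: simple_graph_def)
  moreover have "{u, v} \<in> edges G \<longleftrightarrow> {f u, f v} \<in> (\<lambda>e. f ` e) ` edges G"
    if "u \<in> verts G" "v \<in> verts G" for u v
  proof
    assume "{f u, f v} \<in> (\<lambda>e. f ` e) ` edges G"
    then obtain e where e: "e \<in> edges G" "f ` {u, v} = f ` e" by auto
    then have "{u, v} = e"
      using inj_on_image_eq_iff[OF f, of "{u, v}" e] edg that by auto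
    with e show "{u, v} \<in> edges G" by simp
  next
    assume "{u, v} \<in> edges G"
    then have "f ` {u, v} \<in> (\<lambda>e. f ` e) ` edges G" by (rule imageI)
    then show "{f u, f v} \<in> (\<lambda>e. f ` e) ` edges G" by simp
  qed
  then have "graph_iso G ?H"
    unfolding graph_iso_def using f by (intro exI[of _ f]) (simp add: bij_betw_def)
  ultimately show ?thesis by blast
qed

end

theory Submission
  imports Defs
begin

text \<open>For \<open>A \<subseteq> {0, \<dots>, n - 1}\<close> let \<open>G\<^sub>A\<close> be the graph on \<open>2 n + 1\<close> vertices whose \<open>i\<close>-th edge
  is a ray of a star if \<open>i \<in> A\<close>, and an isolated edge with the same outer vertex otherwise.
  Deleting the \<open>i\<close>-th edge gives the same graph for \<open>A\<close> and for the symmetric difference of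
  \<open>A\<close> and \<open>{i}\<close>. Hence the \<open>G\<^sub>A\<close> with \<open>card A\<close> even and those with \<open>card A\<close> odd have the same
  total edge deck, while the star with \<open>n\<close> edges occurs in only one of the two families.\<close>

definition star_edge :: "nat \<Rightarrow> nat set \<Rightarrow> nat \<Rightarrow> nat set" where
  "star_edge n A i = (if i \<in> A then {0, Suc i} else {Suc i, Suc (n + i)})"

text \<open>The vertex set does not depend on \<open>A\<close>; vertices that no edge uses stay
  isolated. Edge-deleted graphs for different \<open>A\<close> can therefore be equal outright, not
  merely isomorphic.\<close>

definition partial_star :: "nat \<Rightarrow> nat set \<Rightarrow> nat ugraph" where
  "partial_star n A = \<lparr>verts = {..2 * n}, edges = star_edge n A ` {..<n}\<rparr>"

definition toggle :: "'a \<Rightarrow> 'a set \<Rightarrow> 'a set" where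
  "toggle i A = (if i \<in> A then A - {i} else insert i A)"

lemma toggle_toggle [simp]: "toggle i (toggle i A) = A"
  by (auto simp: toggle_def)

lemma even_card_toggle:
  assumes "finite A"
  shows "even (card (toggle i A)) \<longleftrightarrow> odd (card A)"
proof (cases "i \<in> A")
  case True
  then obtain B where "A = insert i B" "i \<notin> B" by (blast dest: mk_disjoint_insert)
  with assms show ?thesis by (simp add: toggle_def)
next
  case False
  with assms show ?thesis by (simp add: toggle_def)
qed

lemma bij_betw_toggle_parity:
  assumes "finite S" and "i \<in> S"
  shows "bij_betw (toggle i) {A. A \<subseteq> S \<and> even (card A)} {A. A \<subseteq> S \<and> odd (card A)}"
proof -
  have sub: "toggle i A \<subseteq> S" if "A \<subseteq> S" for A
    using assms(2) that by (auto simp: toggle_def)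
  have "even (card (toggle i A)) \<longleftrightarrow> odd (card A)" if "A \<subseteq> S" for A
    using finite_subset[OF that assms(1)] by (rule even_card_toggle)
  with sub show ?thesis
    by (intro bij_betw_byWitness[where f' = "toggle i"]) auto
qed

text \<open>The second ends of isolated edges have labels above \<open>n\<close>, so the outer
  vertex \<open>Suc i\<close> lies on the \<open>i\<close>-th edge alone and recovers its
  index.\<close>

lemma Suc_mem_star_edge_iff:
  "i < n \<Longrightarrow> Suc i \<in> star_edge n A j \<longleftrightarrow> i = j"
  by (auto simp: star_edge_def)

lemma inj_on_star_edge: "inj_on (star_edge n A) {..<n}"
  by (rule inj_onI) (metis Suc_mem_star_edge_iff lessThan_iff)

lemma simple_graph_partial_star: "simple_graph (partial_star n A)"
  by (auto simp: simple_graph_def partial_star_def star_edge_def)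

lemma card_edges_partial_star: "card (edges (partial_star n A)) = n"
  by (simp add: partial_star_def card_image inj_on_star_edge)

text \<open>The \<open>j\<close>-th edge depends on \<open>A\<close> only through whether
  \<open>j\<close> lies in \<open>A\<close>, and by injectivity the deletion removes index
  \<open>i\<close> and no other.\<close>

lemma del_edge_partial_star_toggle:
  assumes "i < n"
  shows "del_edge (partial_star n (toggle i A)) (star_edge n (toggle i A) i) =
         del_edge (partial_star n A) (star_edge n A i)"
proof -
  have *: "star_edge n B ` {..<n} - {star_edge n B i} = star_edge n B ` ({..<n} - {i})" for B
    using inj_on_image_set_diff[of "star_edge n B" "{..<n}" "{..<n}" "{i}"] assms
    by (simp add: inj_on_star_edge)
  have "star_edge n (toggle i A) j = star_edge n A j" if "j \<noteq> i" for j
    using that by (auto simp: star_edge_def toggle_def)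
  then have "star_edge n (toggle i A) ` ({..<n} - {i}) = star_edge n A ` ({..<n} - {i})"
    by (intro image_cong) auto
  with * show ?thesis by (simp add: del_edge_def partial_star_def)
qed

text \<open>Indexing the deck by \<open>i < n\<close> gives a range independent of \<open>A\<close>,
  which allows the sums over \<open>i\<close> and over \<open>A\<close> to be exchanged.\<close>

lemma edge_deck_partial_star:
  "edge_deck (partial_star n A) =
     (\<Sum>i<n. {#iso_class (del_edge (partial_star n A) (star_edge n A i))#})"
proof -
  have "mset_set (edges (partial_star n A)) = image_mset (star_edge n A) (mset_set {..<n})"
    by (simp add: partial_star_def image_mset_mset_set inj_on_star_edge)
  then show ?thesis
    by (simp add: edge_deck_def multiset.map_comp comp_def sum_unfold_sum_mset)
qed

lemma sum_edge_deck_partial_star_parity: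
  "(\<Sum>A | A \<subseteq> {..<n} \<and> even (card A). edge_deck (partial_star n A)) =
   (\<Sum>A | A \<subseteq> {..<n} \<and> odd (card A). edge_deck (partial_star n A))"
proof -
  let ?c = "\<lambda>A i. {#iso_class (del_edge (partial_star n A) (star_edge n A i))#}"
  let ?even = "{A. A \<subseteq> {..<n} \<and> even (card A)}"
  let ?odd = "{A. A \<subseteq> {..<n} \<and> odd (card A)}"
  \<comment> \<open>The bijection \<open>toggle i\<close> between the two families varies with
    \<open>i\<close>, so the cards are matched for each fixed \<open>i\<close> before summing over
    \<open>i\<close>.\<close>
  have "(\<Sum>A\<in>?even. ?c A i) = (\<Sum>A\<in>?odd. ?c A i)" if "i < n" for i
  proof -
    have "(\<Sum>A\<in>?even. ?c A i) = (\<Sum>A\<in>?even. ?c (toggle i A) i)"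
      using that by (simp add: del_edge_partial_star_toggle)
    also have "\<dots> = (\<Sum>A\<in>?odd. ?c A i)"
      by (rule sum.reindex_bij_betw[OF bij_betw_toggle_parity]) (use that in auto)
    finally show ?thesis .
  qed
  then have "(\<Sum>i<n. \<Sum>A\<in>?even. ?c A i) = (\<Sum>i<n. \<Sum>A\<in>?odd. ?c A i)"
    by (rule sum.cong[OF refl]) simp
  then show ?thesis
    unfolding edge_deck_partial_star by (simp only: sum.swap[of _ _ "{..<n}"])
qed

text \<open>This is the invariant that singles out the full star. Each edge of \<open>H\<close> is
  the image of an edge of \<open>G\<close>, so it contains the image of \<open>v\<close>.\<close>

lemma graph_iso_common_vertex:
  assumes "simple_graph H" and "graph_iso G H"
    and "v \<in> verts G" and "\<forall>e \<in> edges G. v \<in> e"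
  shows "\<exists>w \<in> verts H. \<forall>e \<in> edges H. w \<in> e"
proof -
  obtain f where f: "bij_betw f (verts G) (verts H)"
    and fe: "\<forall>x \<in> verts G. \<forall>y \<in> verts G. {x, y} \<in> edges G \<longleftrightarrow> {f x, f y} \<in> edges H"
    using assms(2) unfolding graph_iso_def by blast
  have "f v \<in> e" if "e \<in> edges H" for e
  proof -
    have "card e = 2" "e \<subseteq> f ` verts G"
      using assms(1) that bij_betw_imp_surj_on[OF f] by (auto simp: simple_graph_def)
    then obtain x y where xy: "x \<in> verts G" "y \<in> verts G" "e = {f x, f y}"
      by (auto simp: card_2_iff)
    then have "{x, y} \<in> edges G" using fe that by simp
    then have "v \<in> {x, y}" by (rule bspec[OF assms(4)])
    with xy show ?thesis by auto
  qed
  moreover have "f v \<in> verts H" using f assms(3) by (auto dest: bij_betwE)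
  ultimately show ?thesis by blast
qed

text \<open>An index outside \<open>A\<close> yields an isolated edge, which is disjoint from every
  other edge; for \<open>n \<ge> 2\<close> there is another one, so no vertex lies on all
  edges.\<close>

lemma graph_iso_full_star_imp_eq:
  assumes "n \<ge> 2" and "A \<subseteq> {..<n}" and "graph_iso (partial_star n {..<n}) (partial_star n A)"
  shows "A = {..<n}"
proof -
  have "\<exists>w \<in> verts (partial_star n A). \<forall>e \<in> edges (partial_star n A). w \<in> e"
    by (rule graph_iso_common_vertex[OF simple_graph_partial_star assms(3), of 0])
      (auto simp: partial_star_def star_edge_def)
  then obtain w where w: "\<And>i. i < n \<Longrightarrow> w \<in> star_edge n A i"
    by (auto simp: partial_star_def)
  have "i \<in> A" if "i < n" for i
  proof (rule ccontr)
    assume "i \<notin> A"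
    obtain j where j: "j < n" "j \<noteq> i"
      using assms(1) by (intro that[of "if i = 0 then 1 else 0"]) auto
    show False
      using w[OF that] w[OF j(1)] \<open>i \<notin> A\<close> that j by (auto simp: star_edge_def split: if_splits)
  qed
  with assms(2) show ?thesis by auto
qed

theorem theorem3:
  fixes n :: nat
  assumes "n \<ge> 2"
  shows "\<exists>k::nat. k \<ge> 1 \<and>
    (\<exists>G :: nat \<Rightarrow> nat ugraph.
      (\<forall>i \<in> {1..k}. simple_graph (G i) \<and> card (edges (G i)) = n) \<and>
      (\<exists>G' :: nat \<Rightarrow> nat ugraph.
        (\<forall>i \<in> {1..k}. simple_graph (G' i) \<and> card (edges (G' i)) = n) \<and>
        (\<Sum>i = 1..k. edge_deck (G i)) = (\<Sum>i = 1..k. edge_deck (G' i)) \<and>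
        {#iso_class (G i). i \<in># mset_set {1..k}#} \<noteq> {#iso_class (G' i). i \<in># mset_set {1..k}#}))"
proof -
  let ?even = "{A. A \<subseteq> {..<n} \<and> even (card A)}"
  let ?odd = "{A. A \<subseteq> {..<n} \<and> odd (card A)}"
  let ?c = "\<lambda>A. iso_class (partial_star n A)"
  define k where "k = card ?even"
  have fin: "finite ?even" by (rule finite_subset[of _ "Pow {..<n}"]) auto
  have "{} \<in> ?even" by simp
  with fin have "k \<ge> 1" unfolding k_def by (metis One_nat_def Suc_leI card_gt_0_iff empty_iff)
  obtain h where h: "bij_betw h {1..k} ?even"
    using ex_bij_betw_nat_finite_1[OF fin] k_def by blast
  have "bij_betw (toggle 0) ?even ?odd"
    using assms by (intro bij_betw_toggle_parity) auto
  \<comment> \<open>Toggling one fixed index shows that the odd family also has \<open>k\<close>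
    members and enumerates it.\<close>
  with h have h': "bij_betw (toggle 0 \<circ> h) {1..k} ?odd" by (rule bij_betw_trans)
  define G where "G i = partial_star n (h i)" for i
  define G' where "G' i = partial_star n ((toggle 0 \<circ> h) i)" for i
  have "(\<Sum>i = 1..k. edge_deck (G i)) = (\<Sum>i = 1..k. edge_deck (G' i))"
    unfolding G_def G'_def sum.reindex_bij_betw[OF h, of "\<lambda>A. edge_deck (partial_star n A)"]
      sum.reindex_bij_betw[OF h', of "\<lambda>A. edge_deck (partial_star n A)"]
    by (rule sum_edge_deck_partial_star_parity)
  moreover have "{#iso_class (G i). i \<in># mset_set {1..k}#} \<noteq> {#iso_class (G' i). i \<in># mset_set {1..k}#}"
  proof
    assume "{#iso_class (G i). i \<in># mset_set {1..k}#} = {#iso_class (G' i). i \<in># mset_set {1..k}#}"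
    \<comment> \<open>Different sets \<open>A\<close> may give isomorphic graphs, but multiplicities
      can be ignored: already the sets of classes differ.\<close>
    then have "set_mset {#iso_class (G i). i \<in># mset_set {1..k}#} =
        set_mset {#iso_class (G' i). i \<in># mset_set {1..k}#}" by (rule arg_cong)
    then have "?c ` (h ` {1..k}) = ?c ` ((toggle 0 \<circ> h) ` {1..k})"
      by (simp add: image_image G_def G'_def)
    then have eq: "?c ` ?even = ?c ` ?odd"
      by (simp only: bij_betw_imp_surj_on[OF h] bij_betw_imp_surj_on[OF h'])
    have full: "A = {..<n}" if "A \<subseteq> {..<n}" "?c {..<n} = ?c A" for A
      using graph_iso_full_star_imp_eq[OF assms that(1)] that(2)
      by (simp add: iso_class_eq_iff simple_graph_partial_star)
    show False
    \<comment> \<open>The parity of \<open>n\<close> decides which family contains the full star; by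
      \<open>eq\<close> its class would also occur in the other, where \<open>full\<close> forces a
      set of size \<open>n\<close> with the wrong parity.\<close>
    proof (cases "even n")
      case True
      then have "?c {..<n} \<in> ?c ` ?odd" unfolding eq[symmetric] by (intro imageI) simp
      then obtain A where "A \<subseteq> {..<n}" "odd (card A)" "?c {..<n} = ?c A" by blast
      with full[of A] True show False by simp
    next
      case False
      then have "?c {..<n} \<in> ?c ` ?even" unfolding eq by (intro imageI) simp
      then obtain A where "A \<subseteq> {..<n}" "even (card A)" "?c {..<n} = ?c A" by blast
      with full[of A] False show False by simp
    qed
  qed
  moreover have "\<forall>i \<in> {1..k}. simple_graph (G i) \<and> card (edges (G i)) = n"
    and "\<forall>i \<in> {1..k}. simple_graph (G' i) \<and> card (edges (G' i)) = n"
    by (simp_all add: G_def G'_def simple_graph_partial_star card_edges_partial_star)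
  ultimately show ?thesis
    using \<open>k \<ge> 1\<close>
    by (intro exI[of _ k] exI[of _ G] exI[of _ G'] conjI)
qed

end
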